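(* Let $\mathcal{G}=(\mathcal{N},\mathcal{X}=\prod_{i=1}^N\mathbb{R}^{n_i},\{u_i\}_{i=1}^N)$ be a $\lambda$-cocoercive continuous game ($\lambda>0$) whose set of Nash equilibria $\mathcal{X}^*$ is nonempty. Let $(\mathbf{x}_t)_{t\ge0}$ be the noisy online gradient descent iterates $\mathbf{x}_{t+1}=\mathbf{x}_t+\eta_{t+1}(\mathbf{v}(\mathbf{x}_t)+\xi_{t+1})$ with relative random noise, i.e. $\mathbb{E}[\xi_{t+1}\mid\mathcal{F}_t]=0$ and $\mathbb{E}[\|\xi_{t+1}\|^2\mid\mathcal{F}_t]\le\tau_t\|\mathbf{v}(\mathbf{x}_t)\|^2$ for all $t\ge 0$, where $\tau_t\in(0,\tau]$ for some $\tau<+\infty$. Suppose the step-size sequence satisfies $0<\underline{\eta}\le\eta_t\le\overline{\eta}<\lambda/(1+\tau)$ for all $t\ge1$. Then $\mathbf{x}_t$ converges to $\mathcal{X}^*$ almost surely.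
   Context: A continuous game $\mathcal{G}=(\mathcal{N},\mathcal{X}=\prod_{i=1}^N\mathcal{X}_i,\{u_i\}_{i=1}^N)$ consists of a finite set of players $\mathcal{N}=\{1,\dots,N\}$, action sets $\mathcal{X}_i$ (here $\mathcal{X}_i=\mathbb{R}^{n_i}$), and payoff functions $u_i:\mathcal{X}\to\mathbb{R}$ such that each $u_i$ is continuous in $\mathbf{x}$, continuously differentiable in $x_i$, and the partial gradient $\nabla_{x_i}u_i(\mathbf{x})$ is Lipschitz continuous in $\mathbf{x}$. Write $v_i(\mathbf{x})=\nabla_{x_i}u_i(\mathbf{x})$ and $\mathbf{v}(\mathbf{x})=(v_1(\mathbf{x}),\dots,v_N(\mathbf{x}))$. A point $\mathbf{x}^*\in\mathcal{X}$ is a Nash equilibrium if for every $i$, $u_i(x_i^*,\mathbf{x}_{-i}^* )\ge u_i(x_i,\mathbf{x}_{-i}^* )$ for all $x_i\in\mathcal{X}_i$, where $\mathbf{x}_{-i}$ denotes the joint action of all players except $i$. The game is $\lambda$-cocoercive if $(\mathbf{x}'-\mathbf{x})^\top(\mathbf{v}(\mathbf{x}')-\mathbf{v}(\mathbf{x}))\le-\lambda\|\mathbf{v}(\mathbf{x}')-\mathbf{v}(\mathbf{x})\|^2$ for all $\mathbf{x},\mathbf{x}'\in\mathcal{X}$. The norm $\|\cdot\|$ is Euclidean. The initial point $\mathbf{x}_0$ is arbitrary (deterministic). The noise $(\xi_t)_{t\ge1}$ is an $L^2$-bounded martingale difference sequence adapted to the history $(\mathcal{F}_t)$ of the iterates ($\mathbf{x}_t$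 and $\xi_t$ are $\mathcal{F}_t$-measurable). The step-sizes $\eta_t>0$ form a deterministic nonincreasing sequence, and the $\tau_t$ are deterministic. "$\mathbf{x}_t$ converges to $\mathcal{X}^*$" means that the distance from $\mathbf{x}_t$ to the set $\mathcal{X}^*$ tends to $0$. *)

theory Defs
  imports "HOL-Probability.Probability"
begin

text \<open>
  Joint actions are vectors in \<open>real ^ 'k\<close>: the index type \<open>'k\<close> enumerates all scalar
  coordinates of all players, and \<open>pl k\<close> is the player (of the finite type \<open>'p\<close>) who owns
  coordinate \<open>k\<close>. Thus player \<open>i\<close> has the action set of dimension \<open>card {k. pl k = i}\<close>; these
  dimensions may differ from player to player, and \<open>real ^ 'k\<close> with its Euclidean norm and
  inner product is their product. A vector of player \<open>i\<close>'s own action space is represented by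
  its block \<open>{k. pl k = i}\<close> of coordinates.
\<close>

text \<open>The joint action in which player \<open>i\<close> plays \<open>i\<close>'s block of \<open>y\<close>, all others play \<open>x\<close>.\<close>

definition deviate :: "('k \<Rightarrow> 'p) \<Rightarrow> 'p \<Rightarrow> real ^ 'k \<Rightarrow> real ^ 'k \<Rightarrow> real ^ 'k::finite" where
  "deviate pl i x y = (\<chi> k. if pl k = i then y $ k else x $ k)"

definition nash_equilibria ::
    "('k \<Rightarrow> 'p) \<Rightarrow> ('p \<Rightarrow> real ^ 'k \<Rightarrow> real) \<Rightarrow> (real ^ 'k::finite) set" where
  "nash_equilibria pl u = {x. \<forall>i y. u i x \<ge> u i (deviate pl i x y)}"

text \<open>
  The gradient of \<open>u i\<close> with respect to player \<open>i\<close>'s own action. Since \<open>deviate pl i x y\<close>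
  depends only on the \<open>i\<close>-block of \<open>y\<close>, the gradient in \<open>y\<close> vanishes outside that block.
\<close>

definition partial_gradient ::
    "('k \<Rightarrow> 'p) \<Rightarrow> ('p \<Rightarrow> real ^ 'k \<Rightarrow> real) \<Rightarrow> 'p \<Rightarrow> real ^ 'k \<Rightarrow> real ^ 'k::finite" where
  "partial_gradient pl u i x = (THE D. GDERIV (\<lambda>y. u i (deviate pl i x y)) x :> D)"

text \<open>The concatenation of the partial gradients of all players.\<close>

definition game_gradient ::
    "('k \<Rightarrow> 'p) \<Rightarrow> ('p \<Rightarrow> real ^ 'k \<Rightarrow> real) \<Rightarrow> real ^ 'k \<Rightarrow> real ^ 'k::finite" where
  "game_gradient pl u x = (\<chi> k. partial_gradient pl u (pl k) x $ k)"

text \<open>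
  The third condition is continuity of the partial gradient in the player's own action, with the
  actions of the others held fixed; it also follows from the fourth.
\<close>

definition continuous_game ::
    "('k \<Rightarrow> 'p::finite) \<Rightarrow> ('p \<Rightarrow> real ^ 'k::finite \<Rightarrow> real) \<Rightarrow> bool" where
  "continuous_game pl u \<longleftrightarrow>
     (\<forall>i. continuous_on UNIV (u i) \<and>
          (\<forall>x. (\<lambda>y. u i (deviate pl i x y)) differentiable_on UNIV) \<and>
          (\<forall>x. continuous_on UNIV (\<lambda>y. partial_gradient pl u i (deviate pl i x y))) \<and>
          (\<exists>L. L-lipschitz_on UNIV (partial_gradient pl u i)))"

definition cocoercive_game ::
    "real \<Rightarrow> ('k \<Rightarrow> 'p::finite) \<Rightarrow> ('p \<Rightarrow> real ^ 'k::finite \<Rightarrow> real) \<Rightarrow> bool" where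
  "cocoercive_game lam pl u \<longleftrightarrow>
     continuous_game pl u \<and>
     (\<forall>x x'. (x' - x) \<bullet> (game_gradient pl u x' - game_gradient pl u x)
              \<le> - lam * (norm (game_gradient pl u x' - game_gradient pl u x))\<^sup>2)"

text \<open>
  \<open>\<xi> t\<close> is indexed by \<open>t \<ge> 1\<close>; the value \<open>\<xi> 0\<close> is unconstrained. The conditional expectation
  of a vector is taken coordinatewise, \<open>real_cond_exp\<close> being real-valued.
\<close>

definition L2_bounded_martingale_difference ::
    "'w measure \<Rightarrow> (nat \<Rightarrow> 'w measure) \<Rightarrow> (nat \<Rightarrow> 'w \<Rightarrow> real ^ 'k::finite) \<Rightarrow> bool" where
  "L2_bounded_martingale_difference M F \<xi> \<longleftrightarrow>
     (\<forall>t\<ge>1. \<xi> t \<in> borel_measurable (F t)) \<and>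
     (\<forall>t\<ge>1. integrable M (\<lambda>\<omega>. (norm (\<xi> t \<omega>))\<^sup>2)) \<and>
     (\<exists>C. \<forall>t\<ge>1. (\<integral>\<omega>. (norm (\<xi> t \<omega>))\<^sup>2 \<partial>M) \<le> C) \<and>
     (\<forall>t. \<forall>k. AE \<omega> in M. real_cond_exp M (F t) (\<lambda>\<omega>. \<xi> (Suc t) \<omega> $ k) \<omega> = 0)"

end

theory Submission
  imports Defs
begin

text \<open>
  By cocoercivity the equilibria are exactly the zeros of \<open>v\<close>. For an equilibrium \<open>x*\<close> and
  \<open>D\<^sub>t = |X\<^sub>t - x*|\<^sup>2\<close>, expanding the square gives
  \<open>E[D\<^sub>t\<^sub>+\<^sub>1 | F\<^sub>t] \<le> D\<^sub>t - \<eta>\<^sub>t\<^sub>+\<^sub>1 \<lambda> |v(X\<^sub>t)|\<^sup>2\<close>, since \<open>\<eta>\<^sub>t\<^sub>+\<^sub>1 (1 + \<tau>) \<le> \<lambda>\<close>. Hence the sum of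
  the \<open>E |v(X\<^sub>t)|\<^sup>2\<close> is finite, so \<open>v(X\<^sub>t) \<longrightarrow> 0\<close> almost surely, and Ville's maximal inequality
  shows that \<open>X\<^sub>t\<close> is almost surely bounded. By compactness these two facts suffice; the
  convergence theorem for supermartingales is not needed.
\<close>

section \<open>Equilibria of cocoercive games\<close>

lemma deviate_self [simp]: "deviate pl i x x = x"
  by (simp add: deviate_def vec_eq_iff)

lemma deviate_deviate [simp]: "deviate pl i (deviate pl i x y) z = deviate pl i x z"
  by (auto simp: deviate_def vec_eq_iff)

lemma deviate_idem [simp]: "deviate pl i x (deviate pl i x y) = deviate pl i x y"
  by (simp add: deviate_def vec_eq_iff)

text \<open>Riesz representation: the derivative is a linear functional
  \<open>h \<mapsto> h \<bullet> D\<close> with \<open>D = adjoint f' 1\<close>, and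
  \<open>D\<close> inherits uniqueness from the derivative. This makes the \<open>THE\<close> in
  \<open>partial_gradient\<close> well defined.\<close>

lemma GDERIV_ex1:
  fixes f :: "'a::euclidean_space \<Rightarrow> real"
  assumes "f differentiable (at x)"
  shows "\<exists>!D. GDERIV f x :> D"
proof -
  obtain f' where f': "(f has_derivative f') (at x)"
    using assms by (auto simp: differentiable_def)
  have "linear f'"
    using f' by (rule has_derivative_linear)
  then have "f' h = h \<bullet> adjoint f' 1" for h
    by (simp add: adjoint_works)
  then have "f' = (\<lambda>h. h \<bullet> adjoint f' 1)"
    by blast
  with f' have ex: "GDERIV f x :> adjoint f' 1"
    by (simp add: gderiv_def)
  have "D = D'" if "GDERIV f x :> D" "GDERIV f x :> D'" for D D'
  proof -
    have "(\<lambda>h. h \<bullet> D) = (\<lambda>h. h \<bullet> D')"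
      using that unfolding gderiv_def by (rule has_derivative_unique)
    from fun_cong[OF this, of "D - D'"] have "(D - D') \<bullet> (D - D') = 0"
      by (simp add: inner_diff_right)
    then show ?thesis
      by simp
  qed
  with ex show ?thesis
    by blast
qed

lemma GDERIV_partial_gradient:
  assumes "continuous_game pl u"
  shows "GDERIV (\<lambda>y. u i (deviate pl i x y)) x :> partial_gradient pl u i x"
proof -
  have "(\<lambda>y. u i (deviate pl i x y)) differentiable (at x)"
    using assms by (auto simp: continuous_game_def differentiable_on_def)
  from theI'[OF GDERIV_ex1[OF this]] show ?thesis
    by (simp add: partial_gradient_def)
qed

text \<open>Coordinate \<open>k\<close> of \<open>game_gradient\<close> comes from the gradient of
  its owner \<open>pl k\<close>, so a direction in which only player \<open>i\<close> moves sees
  only the partial gradient of \<open>i\<close>. This carries cocoercivity, a joint condition, over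
  to one player's payoff.\<close>

lemma inner_game_gradient:
  assumes "\<And>k. pl k \<noteq> i \<Longrightarrow> d $ k = 0"
  shows "d \<bullet> game_gradient pl u x = d \<bullet> partial_gradient pl u i x"
  unfolding inner_vec_def game_gradient_def by (rule sum.cong) (use assms in force)+

text \<open>Fermat's first-order condition: action sets are whole spaces, so each player's best
  response is an interior maximum.\<close>

lemma nash_imp_game_gradient_0:
  assumes "continuous_game pl u" "x \<in> nash_equilibria pl u"
  shows "game_gradient pl u x = 0"
proof -
  have "partial_gradient pl u i x = 0" for i
  proof -
    have "(\<lambda>h. h \<bullet> partial_gradient pl u i x) = (\<lambda>h. 0)"
    proof (rule differential_zero_maxmin[of x UNIV])
      show "((\<lambda>y. u i (deviate pl i x y)) has_derivative (\<lambda>h. h \<bullet> partial_gradient pl u i x)) (at x)"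
        using GDERIV_partial_gradient[OF assms(1)] by (simp add: gderiv_def)
    qed (use assms(2) in \<open>auto simp: nash_equilibria_def\<close>)
    from fun_cong[OF this, of "partial_gradient pl u i x"] show ?thesis
      by simp
  qed
  then show ?thesis
    by (simp add: game_gradient_def vec_eq_iff)
qed

text \<open>
  Cocoercivity makes \<open>u i\<close> concave in player \<open>i\<close>'s own action, so a critical point is a maximum.
\<close>

lemma game_gradient_0_imp_nash:
  assumes coco: "cocoercive_game lam pl u" and "lam \<ge> 0" and v0: "game_gradient pl u x = 0"
  shows "x \<in> nash_equilibria pl u"
proof -
  have game: "continuous_game pl u"
    using coco by (simp add: cocoercive_game_def)
  have "u i (deviate pl i x y) \<le> u i x" for i y
  proof -
    define d where "d = deviate pl i x y - x"
    have d0: "d $ k = 0" if "pl k \<noteq> i" for k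
      using that by (simp add: d_def deviate_def)
    \<comment> \<open>Since \<open>d\<close> lives on the block of player \<open>i\<close>, the
      whole line through \<open>x\<close> in direction \<open>d\<close> consists of unilateral
      deviations of \<open>i\<close> from \<open>x\<close>.\<close>
    have dev: "deviate pl i x (x + s *\<^sub>R d) = x + s *\<^sub>R d" for s
      using d0 by (auto simp: deviate_def vec_eq_iff)
    define \<phi> where "\<phi> s = u i (deviate pl i x (x + s *\<^sub>R d))" for s
    have deriv: "(\<phi> has_real_derivative d \<bullet> game_gradient pl u (x + s *\<^sub>R d)) (at s)" for s
    proof -
      let ?w = "x + s *\<^sub>R d"
      \<comment> \<open>The opponents play the same at \<open>?w\<close> as at \<open>x\<close>, so
        the partial gradient at \<open>?w\<close> differentiates the very function whose restriction
        to the line is \<open>\<phi>\<close>.\<close>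
      have slice: "deviate pl i ?w y = deviate pl i x y" for y
        using deviate_deviate[of pl i x ?w y] unfolding dev .
      have "((\<lambda>y. u i (deviate pl i x y)) has_derivative (\<lambda>h. h \<bullet> partial_gradient pl u i ?w)) (at ?w)"
        using GDERIV_partial_gradient[OF game, of i ?w] slice by (simp add: gderiv_def)
      moreover have "((\<lambda>s. x + s *\<^sub>R d) has_derivative (\<lambda>h. h *\<^sub>R d)) (at s)"
        by (auto intro!: derivative_eq_intros)
      ultimately have "(\<phi> has_derivative (\<lambda>h. (h *\<^sub>R d) \<bullet> partial_gradient pl u i ?w)) (at s)"
        unfolding \<phi>_def by (rule has_derivative_compose[rotated])
      moreover have "d \<bullet> game_gradient pl u ?w = d \<bullet> partial_gradient pl u i ?w"
        by (rule inner_game_gradient) (rule d0)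
      ultimately show ?thesis
        by (simp add: has_field_derivative_def mult_commute_abs)
    qed
    \<comment> \<open>Cocoercivity between \<open>x\<close> and \<open>x + s *\<^sub>R d\<close>
      bounds \<open>s\<close> times the slope of \<open>\<phi>\<close>. Dividing needs
      \<open>s > 0\<close>; at \<open>s = 0\<close> the slope vanishes by \<open>v0\<close>.\<close>
    have nonpos: "d \<bullet> game_gradient pl u (x + s *\<^sub>R d) \<le> 0" if "0 \<le> s" for s
    proof (cases "s = 0")
      case False
      have "(x + s *\<^sub>R d - x) \<bullet> (game_gradient pl u (x + s *\<^sub>R d) - game_gradient pl u x)
          \<le> - lam * (norm (game_gradient pl u (x + s *\<^sub>R d) - game_gradient pl u x))\<^sup>2"
        using coco unfolding cocoercive_game_def by blast
      also have "\<dots> \<le> 0"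
        using \<open>lam \<ge> 0\<close> by simp
      finally show ?thesis
        using that False v0 by (simp add: mult_le_0_iff)
    qed (simp add: v0)
    have "\<phi> 1 \<le> \<phi> 0"
      by (rule DERIV_nonpos_imp_nonincreasing) (use deriv nonpos in auto)
    then show ?thesis
      by (simp add: \<phi>_def d_def)
  qed
  then show ?thesis
    by (simp add: nash_equilibria_def)
qed

lemma nash_iff_game_gradient_0:
  assumes "cocoercive_game lam pl u" "lam \<ge> 0"
  shows "x \<in> nash_equilibria pl u \<longleftrightarrow> game_gradient pl u x = 0"
  using assms nash_imp_game_gradient_0 game_gradient_0_imp_nash
  by (metis cocoercive_game_def)

text \<open>Cauchy-Schwarz applied to the cocoercivity inequality, after which one factor of the
  norm of the gradient difference cancels.\<close>

lemma lipschitz_game_gradient: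
  assumes "cocoercive_game lam pl u" "lam > 0"
  shows "(1 / lam)-lipschitz_on UNIV (game_gradient pl u)"
proof (rule lipschitz_onI)
  fix x y
  let ?v = "game_gradient pl u"
  have "lam * (norm (?v x - ?v y))\<^sup>2 \<le> - ((x - y) \<bullet> (?v x - ?v y))"
  proof -
    have "(x - y) \<bullet> (?v x - ?v y) \<le> - lam * (norm (?v x - ?v y))\<^sup>2"
      using assms(1) unfolding cocoercive_game_def by blast
    then show ?thesis
      by simp
  qed
  also have "\<dots> \<le> norm (x - y) * norm (?v x - ?v y)"
    using Cauchy_Schwarz_ineq2[of "x - y" "?v x - ?v y"] by linarith
  finally have "lam * norm (?v x - ?v y) \<le> norm (x - y)"
    by (cases "?v x = ?v y") (simp_all add: power2_eq_square mult.assoc[symmetric])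
  then show "dist (?v x) (?v y) \<le> 1 / lam * dist x y"
    using assms(2) by (simp add: dist_norm field_simps)
qed (use assms in simp)

text \<open>Within the closure of the sequence, the points at distance at least \<open>e\<close>
  from the zeros form a compact set \<open>K\<close> on which \<open>norm (v y)\<close> has a
  positive lower bound \<open>m\<close>. Once \<open>norm (v (x t)) < m\<close>, the point
  \<open>x t\<close> lies outside \<open>K\<close>.\<close>

lemma infdist_zeros_tendsto_0:
  fixes x :: "nat \<Rightarrow> 'a::heine_borel" and v :: "'a \<Rightarrow> 'b::real_normed_vector"
  assumes cont: "continuous_on UNIV v" and bdd: "bounded (range x)"
    and lim: "(\<lambda>t. v (x t)) \<longlonglongrightarrow> 0"
  shows "(\<lambda>t. infdist (x t) {y. v y = 0}) \<longlonglongrightarrow> 0"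
proof (rule order_tendstoI)
  fix e :: real
  assume e: "0 < e"
  let ?S = "{y. v y = 0}"
  define K where "K = closure (range x) \<inter> {y. infdist y ?S \<ge> e}"
  have "closed {y. infdist y ?S \<ge> e}"
    by (intro closed_Collect_le continuous_intros)
  then have "compact K"
    using bdd by (simp add: K_def compact_Int_closed)
  have "\<exists>m>0. \<forall>y\<in>K. m \<le> norm (v y)"
  proof (cases "K = {}")
    case False
    have "continuous_on K (\<lambda>y. norm (v y))"
      by (intro continuous_intros continuous_on_subset[OF cont]) simp
    then obtain y0 where y0: "y0 \<in> K" "\<And>y. y \<in> K \<Longrightarrow> norm (v y0) \<le> norm (v y)"
      using continuous_attains_inf[OF \<open>compact K\<close> False] by blast
    \<comment> \<open>A zero of \<open>v\<close> has distance 0 from \<open>?S\<close>, whereas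
      points of \<open>K\<close> have distance at least \<open>e > 0\<close>.\<close>
    have "v y0 \<noteq> 0"
      using y0(1) e by (auto simp: K_def)
    with y0 show ?thesis
      by (intro exI[of _ "norm (v y0)"]) auto
  qed (auto intro: exI[of _ 1])
  then obtain m where m: "m > 0" "\<And>y. y \<in> K \<Longrightarrow> m \<le> norm (v y)"
    by blast
  have "eventually (\<lambda>t. norm (v (x t)) < m) sequentially"
    using lim m(1) by (metis order_tendstoD(2) tendsto_norm_zero)
  then show "eventually (\<lambda>t. infdist (x t) ?S < e) sequentially"
  proof eventually_elim
    case (elim t)
    then have "x t \<notin> K"
      using m(2) by fastforce
    then show ?case
      using closure_subset[of "range x"] by (auto simp: K_def not_le)
  qed
qed (auto intro!: always_eventually less_le_trans[OF _ infdist_nonneg])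

section \<open>Almost sure bounds\<close>

text \<open>By monotone convergence the series of the \<open>f t\<close> has a finite integral, so
  it converges almost everywhere and its terms tend to 0.\<close>

lemma AE_tendsto_0_of_summable_integral:
  fixes f :: "nat \<Rightarrow> 'a \<Rightarrow> real"
  assumes int: "\<And>t. integrable M (f t)" and nonneg: "\<And>t \<omega>. 0 \<le> f t \<omega>"
    and bound: "\<And>n. (\<Sum>t<n. \<integral>\<omega>. f t \<omega> \<partial>M) \<le> B"
  shows "AE \<omega> in M. (\<lambda>t. f t \<omega>) \<longlonglongrightarrow> 0"
proof -
  note [measurable] = borel_measurable_integrable[OF int]
  have "(\<integral>\<^sup>+\<omega>. (\<Sum>t. ennreal (f t \<omega>)) \<partial>M) = (\<Sum>t. \<integral>\<^sup>+\<omega>. ennreal (f t \<omega>) \<partial>M)"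
    by (rule nn_integral_suminf) simp
  also have "\<dots> = (\<Sum>t. ennreal (\<integral>\<omega>. f t \<omega> \<partial>M))"
    by (simp add: nn_integral_eq_integral int nonneg)
  also have "\<dots> \<le> ennreal B"
    by (intro suminf_le_const) (simp_all add: sum_ennreal nonneg bound ennreal_leI)
  finally have "(\<integral>\<^sup>+\<omega>. (\<Sum>t. ennreal (f t \<omega>)) \<partial>M) \<noteq> \<infinity>"
    by (auto simp: top_unique)
  then have "AE \<omega> in M. (\<Sum>t. ennreal (f t \<omega>)) \<noteq> \<infinity>"
    by (intro nn_integral_PInf_AE) simp_all
  then show ?thesis
  proof eventually_elim
    case (elim \<omega>)
    then show ?case
      using nonneg by (intro summable_LIMSEQ_zero summable_suminf_not_top) simp_all
  qed
qed

text \<open>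
  Ville's maximal inequality: \<open>Z t\<close> below is \<open>D\<close> frozen at the level \<open>c\<close> once \<open>D\<close> has reached
  \<open>c\<close>, and it has nonincreasing expectation.
\<close>

lemma (in prob_space) supermartingale_maximal:
  fixes D :: "nat \<Rightarrow> 'a \<Rightarrow> real"
  assumes filt: "filtration (space M) F" and sub: "\<And>t. subalgebra M (F t)"
    and meas: "\<And>t. D t \<in> borel_measurable (F t)" and int: "\<And>t. integrable M (D t)"
    and nonneg: "\<And>t \<omega>. 0 \<le> D t \<omega>"
    and super: "\<And>t A. A \<in> sets (F t) \<Longrightarrow>
      (\<integral>\<omega>. indicator A \<omega> * D (Suc t) \<omega> \<partial>M) \<le> (\<integral>\<omega>. indicator A \<omega> * D t \<omega> \<partial>M)"
    and c: "0 \<le> c"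
  shows "c * prob {\<omega> \<in> space M. \<exists>t. c \<le> D t \<omega>} \<le> expectation (D 0)"
proof -
  \<comment> \<open>The level \<open>c\<close> has not been reached up to time \<open>t\<close>.
    This is decided by \<open>F t\<close>, so \<open>super\<close> applies to this event.\<close>
  define A where "A t = {\<omega> \<in> space M. \<forall>s\<le>t. D s \<omega> < c}" for t
  have A_F: "A t \<in> sets (F t)" for t
  proof -
    have "D s \<in> borel_measurable (F t)" if "s \<le> t" for s
      using measurable_mono[OF order_refl refl filtration.sets_F_mono[OF filt that]] meas
      by (auto simp: filtration.space_F[OF filt])
    then have "{\<omega> \<in> space (F t). \<forall>s\<in>{..t}. D s \<omega> < c} \<in> sets (F t)"
      by (intro sets.sets_Collect_finite_All') auto
    moreover have "{\<omega> \<in> space (F t). \<forall>s\<in>{..t}. D s \<omega> < c} = A t"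
      by (auto simp: A_def filtration.space_F[OF filt])
    ultimately show ?thesis
      by simp
  qed
  have A [measurable]: "A t \<in> events" for t
    using A_F sub by (auto simp: subalgebra_def)
  note [measurable] = borel_measurable_integrable[OF int]
  define Z where "Z t \<omega> = indicator (A t) \<omega> * D t \<omega> + c * indicator (space M - A t) \<omega>" for t \<omega>
  have int_ind: "integrable M (\<lambda>\<omega>. indicator (A t) \<omega> * D s \<omega>)" for s t
    using integrable_mult_indicator[OF A int] by simp
  have int_c: "integrable M (\<lambda>\<omega>. c * indicator (space M - A t) \<omega>)" for t
    by (intro integrable_mult_right integrable_real_indicator) (simp_all add: emeasure_eq_measure)
  have Z_int: "integrable M (Z t)" for t
    unfolding Z_def using int_ind int_c by (intro Bochner_Integration.integrable_add)
  have Z_dec: "expectation (Z (Suc t)) \<le> expectation (Z t)" for t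
  proof -
    \<comment> \<open>Pointwise, the two integrands agree except on \<open>A t - A (Suc t)\<close>,
      where the level is first reached at \<open>Suc t\<close> and
      \<open>Z (Suc t) = c \<le> D (Suc t)\<close>.\<close>
    have "expectation (Z (Suc t)) \<le>
        (\<integral>\<omega>. indicator (A t) \<omega> * D (Suc t) \<omega> + c * indicator (space M - A t) \<omega> \<partial>M)"
      by (rule integral_mono[OF Z_int Bochner_Integration.integrable_add[OF int_ind int_c]])
         (auto simp: Z_def A_def indicator_def le_Suc_eq not_less)
    also have "\<dots> \<le> expectation (Z t)"
      unfolding Z_def Bochner_Integration.integral_add[OF int_ind int_c]
      using super[OF A_F] by simp
    finally show ?thesis .
  qed
  have "expectation (Z t) \<le> expectation (D 0)" for t
  proof (induction t)
    case 0
    show ?case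
      by (rule integral_mono[OF Z_int int]) (auto simp: Z_def A_def indicator_def)
  next
    case (Suc t)
    then show ?case
      using Z_dec[of t] by linarith
  qed
  moreover have "c * prob (space M - A t) \<le> expectation (Z t)" for t
  proof -
    have "c * prob (space M - A t) = (\<integral>\<omega>. c * indicator (space M - A t) \<omega> \<partial>M)"
      by simp
    also have "\<dots> \<le> expectation (Z t)"
      by (rule integral_mono[OF int_c Z_int]) (simp add: Z_def nonneg)
    finally show ?thesis .
  qed
  ultimately have le: "c * prob (space M - A t) \<le> expectation (D 0)" for t
    by (rule order_trans[rotated])
  \<comment> \<open>Continuity from below passes from a finite horizon to all times.\<close>
  have "incseq (\<lambda>t. space M - A t)"
    unfolding A_def by (rule incseq_SucI) auto
  then have "(\<lambda>t. prob (space M - A t)) \<longlonglongrightarrow> prob (\<Union>t. space M - A t)"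
    by (intro finite_Lim_measure_incseq) auto
  then have "(\<lambda>t. c * prob (space M - A t)) \<longlonglongrightarrow> c * prob (\<Union>t. space M - A t)"
    by (rule tendsto_mult_left)
  moreover have "(\<Union>t. space M - A t) = {\<omega> \<in> space M. \<exists>t. c \<le> D t \<omega>}"
    by (fastforce simp: A_def not_less)
  ultimately show ?thesis
    using le by (auto intro: LIMSEQ_le_const2)
qed

text \<open>An unbounded path reaches every level \<open>n\<close>, which by the maximal inequality
  has probability at most \<open>expectation (D 0) / n\<close> for each
  \<open>n \<ge> 1\<close>.\<close>

lemma (in prob_space) supermartingale_AE_bounded:
  fixes D :: "nat \<Rightarrow> 'a \<Rightarrow> real"
  assumes filt: "filtration (space M) F" and sub: "\<And>t. subalgebra M (F t)"
    and meas: "\<And>t. D t \<in> borel_measurable (F t)" and int: "\<And>t. integrable M (D t)"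
    and nonneg: "\<And>t \<omega>. 0 \<le> D t \<omega>"
    and super: "\<And>t A. A \<in> sets (F t) \<Longrightarrow>
      (\<integral>\<omega>. indicator A \<omega> * D (Suc t) \<omega> \<partial>M) \<le> (\<integral>\<omega>. indicator A \<omega> * D t \<omega> \<partial>M)"
  shows "AE \<omega> in M. \<exists>c. \<forall>t. D t \<omega> \<le> c"
proof -
  note [measurable] = borel_measurable_integrable[OF int]
  define U where "U c = {\<omega> \<in> space M. \<exists>t. c \<le> D t \<omega>}" for c :: real
  have U [measurable]: "U c \<in> events" for c
    unfolding U_def by measurable
  define N where "N = (\<Inter>n::nat. U (real n))"
  have N [measurable]: "N \<in> events"
    unfolding N_def by measurable
  have "real n * prob N \<le> expectation (D 0)" for n :: nat
  proof -
    have "prob N \<le> prob (U (real n))"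
      by (intro finite_measure_mono) (auto simp: N_def)
    then have "real n * prob N \<le> real n * prob (U (real n))"
      by (simp add: mult_left_mono)
    also have "\<dots> \<le> expectation (D 0)"
      unfolding U_def by (rule supermartingale_maximal[OF assms]) simp_all
    finally show ?thesis .
  qed
  then have "\<not> 0 < prob N"
    using reals_Archimedean3[of "prob N"] by (auto simp: not_le[symmetric])
  then have "prob N = 0"
    by (simp add: zero_less_measure_iff)
  then have "AE \<omega> in M. \<omega> \<notin> N"
    by (intro AE_not_in) (simp add: null_sets_def emeasure_eq_measure)
  with AE_space show ?thesis
  proof eventually_elim
    case (elim \<omega>)
    then obtain n :: nat where "\<omega> \<notin> U (real n)"
      by (auto simp: N_def)
    with elim have "\<forall>t. D t \<omega> \<le> real n"
      by (auto simp: U_def not_le less_imp_le)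
    then show ?case ..
  qed
qed

section \<open>One step of stochastic gradient descent\<close>

text \<open>Domination by Cauchy-Schwarz and
  \<open>norm a * norm b \<le> (norm a)\<^sup>2 + (norm b)\<^sup>2\<close>.\<close>

lemma integrable_inner_of_power2:
  fixes f g :: "'a \<Rightarrow> 'b::euclidean_space"
  assumes [measurable]: "f \<in> borel_measurable M" "g \<in> borel_measurable M"
    and "integrable M (\<lambda>\<omega>. (norm (f \<omega>))\<^sup>2)" "integrable M (\<lambda>\<omega>. (norm (g \<omega>))\<^sup>2)"
  shows "integrable M (\<lambda>\<omega>. f \<omega> \<bullet> g \<omega>)"
proof (rule Bochner_Integration.integrable_bound)
  show "integrable M (\<lambda>\<omega>. (norm (f \<omega>))\<^sup>2 + (norm (g \<omega>))\<^sup>2)"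
    using assms by simp
  have "\<bar>a \<bullet> b\<bar> \<le> (norm a)\<^sup>2 + (norm b)\<^sup>2" for a b :: 'b
  proof -
    have "\<bar>a \<bullet> b\<bar> \<le> norm a * norm b"
      by (rule Cauchy_Schwarz_ineq2)
    also have "\<dots> \<le> (norm a)\<^sup>2 + (norm b)\<^sup>2"
      using sum_squares_bound[of "norm a" "norm b"] mult_nonneg_nonneg[OF norm_ge_zero norm_ge_zero, of a b]
      by linarith
    finally show ?thesis .
  qed
  then show "AE \<omega> in M. norm (f \<omega> \<bullet> g \<omega>) \<le> norm ((norm (f \<omega>))\<^sup>2 + (norm (g \<omega>))\<^sup>2)"
    by simp
qed simp

lemma integrable_power2_norm_add:
  fixes f g :: "'a \<Rightarrow> 'b::euclidean_space"
  assumes "f \<in> borel_measurable M" "g \<in> borel_measurable M"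
    and "integrable M (\<lambda>\<omega>. (norm (f \<omega>))\<^sup>2)" "integrable M (\<lambda>\<omega>. (norm (g \<omega>))\<^sup>2)"
  shows "integrable M (\<lambda>\<omega>. (norm (f \<omega> + g \<omega>))\<^sup>2)"
proof -
  have "(norm (f \<omega> + g \<omega>))\<^sup>2 = (norm (f \<omega>))\<^sup>2 + (norm (g \<omega>))\<^sup>2 + 2 * (f \<omega> \<bullet> g \<omega>)" for \<omega>
    by (simp add: power2_norm_eq_inner inner_add inner_commute)
  then show ?thesis
    using assms by (simp add: integrable_inner_of_power2)
qed

text \<open>Orthogonality of noise to the past: in each coordinate the \<open>F\<close>-measurable
  factor \<open>z \<omega> $ k\<close> is pulled out of the conditional expectation. Square
  integrability makes the products integrable, as this requires.\<close>

lemma (in sigma_finite_subalgebra) integral_inner_cond_exp_0: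
  fixes z \<xi> :: "'a \<Rightarrow> real ^ 'k::finite"
  assumes z: "z \<in> borel_measurable F" and \<xi> [measurable]: "\<xi> \<in> borel_measurable M"
    and int: "integrable M (\<lambda>\<omega>. (norm (z \<omega>))\<^sup>2)" "integrable M (\<lambda>\<omega>. (norm (\<xi> \<omega>))\<^sup>2)"
    and mart: "\<And>k. AE \<omega> in M. real_cond_exp M F (\<lambda>\<omega>. \<xi> \<omega> $ k) \<omega> = 0"
  shows "(\<integral>\<omega>. z \<omega> \<bullet> \<xi> \<omega> \<partial>M) = 0"
proof -
  have zM [measurable]: "z \<in> borel_measurable M"
    using measurable_from_subalg[OF subalg z] .
  have nth: "(\<lambda>x. x $ k) \<in> borel_measurable (borel :: (real ^ 'k) measure)" for k
    by (intro borel_measurable_continuous_onI continuous_intros)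
  have comp: "integrable M (\<lambda>\<omega>. z \<omega> $ k * \<xi> \<omega> $ k)"
    and zero: "(\<integral>\<omega>. z \<omega> $ k * \<xi> \<omega> $ k \<partial>M) = 0" for k
  proof -
    have zk: "(\<lambda>\<omega>. z \<omega> $ k) \<in> borel_measurable F"
      using measurable_compose[OF z nth] .
    have zkM: "(\<lambda>\<omega>. z \<omega> $ k) \<in> borel_measurable M" and \<xi>k: "(\<lambda>\<omega>. \<xi> \<omega> $ k) \<in> borel_measurable M"
      using measurable_compose[OF zM nth] measurable_compose[OF \<xi> nth] .
    have sq: "integrable M (\<lambda>\<omega>. (norm (f \<omega> $ k))\<^sup>2)"
      if "f \<in> borel_measurable M" "integrable M (\<lambda>\<omega>. (norm (f \<omega>))\<^sup>2)"
      for f :: "'a \<Rightarrow> real ^ 'k"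
    proof (rule Bochner_Integration.integrable_bound[OF that(2)])
      show "(\<lambda>\<omega>. (norm (f \<omega> $ k))\<^sup>2) \<in> borel_measurable M"
        using measurable_compose[OF that(1) nth[of k]] by measurable
      have "(norm (f \<omega> $ k))\<^sup>2 \<le> (norm (f \<omega>))\<^sup>2" for \<omega>
        by (rule power_mono) (simp_all add: component_le_norm_cart)
      then show "AE \<omega> in M. norm ((norm (f \<omega> $ k))\<^sup>2) \<le> norm ((norm (f \<omega>))\<^sup>2)"
        by simp
    qed
    show i: "integrable M (\<lambda>\<omega>. z \<omega> $ k * \<xi> \<omega> $ k)"
      using integrable_inner_of_power2[OF zkM \<xi>k sq[OF zM int(1)] sq[OF \<xi> int(2)]] by simp
    have "(\<integral>\<omega>. z \<omega> $ k * \<xi> \<omega> $ k \<partial>M) =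
        (\<integral>\<omega>. z \<omega> $ k * real_cond_exp M F (\<lambda>\<omega>. \<xi> \<omega> $ k) \<omega> \<partial>M)"
      using real_cond_exp_intg(2)[OF i zk \<xi>k] by simp
    also have "\<dots> = (\<integral>\<omega>. 0 \<partial>M)"
      by (rule integral_cong_AE) (use mart[of k] zkM in auto)
    finally show "(\<integral>\<omega>. z \<omega> $ k * \<xi> \<omega> $ k \<partial>M) = 0"
      by simp
  qed
  show ?thesis
    by (simp add: inner_vec_def comp zero Bochner_Integration.integral_sum)
qed

text \<open>To be used with \<open>y\<close> the offset from an equilibrium, \<open>w\<close> the
  gradient and \<open>h\<close> the step. Cocoercivity contributes \<open>- 2 * h * lam\<close>
  times the squared gradient norm, while drift and noise together cost at most
  \<open>h\<^sup>2 * (1 + \<tau>) \<le> h * lam\<close> times it. Integrating over every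
  \<open>A \<in> sets F\<close> expresses the conditional inequality.\<close>

lemma (in sigma_finite_subalgebra) sgd_step_descent:
  fixes y w \<xi> :: "'a \<Rightarrow> real ^ 'k::finite" and h lam \<tau> :: real
  assumes y: "y \<in> borel_measurable F" and w: "w \<in> borel_measurable F"
    and \<xi> [measurable]: "\<xi> \<in> borel_measurable M"
    and y_int: "integrable M (\<lambda>\<omega>. (norm (y \<omega>))\<^sup>2)"
    and w_int: "integrable M (\<lambda>\<omega>. (norm (w \<omega>))\<^sup>2)"
    and \<xi>_int: "integrable M (\<lambda>\<omega>. (norm (\<xi> \<omega>))\<^sup>2)"
    and mart: "\<And>k. AE \<omega> in M. real_cond_exp M F (\<lambda>\<omega>. \<xi> \<omega> $ k) \<omega> = 0"
    and var: "AE \<omega> in M. real_cond_exp M F (\<lambda>\<omega>. (norm (\<xi> \<omega>))\<^sup>2) \<omega> \<le> \<tau> * (norm (w \<omega>))\<^sup>2"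
    and coco: "\<And>\<omega>. y \<omega> \<bullet> w \<omega> \<le> - lam * (norm (w \<omega>))\<^sup>2"
    and h: "0 \<le> h" "h * (1 + \<tau>) \<le> lam"
    and A: "A \<in> sets F"
  shows "(\<integral>\<omega>. indicator A \<omega> * (norm (y \<omega> + h *\<^sub>R (w \<omega> + \<xi> \<omega>)))\<^sup>2 \<partial>M)
       \<le> (\<integral>\<omega>. indicator A \<omega> * (norm (y \<omega>))\<^sup>2 \<partial>M)
         - h * lam * (\<integral>\<omega>. indicator A \<omega> * (norm (w \<omega>))\<^sup>2 \<partial>M)"
proof -
  have [measurable]: "A \<in> sets M"
    using A subalg by (auto simp: subalgebra_def)
  have yM [measurable]: "y \<in> borel_measurable M" and wM [measurable]: "w \<in> borel_measurable M"
    using measurable_from_subalg[OF subalg] y w by auto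
  have ind: "integrable M (\<lambda>\<omega>. indicator A \<omega> * f \<omega>)" if "integrable M f" for f :: "'a \<Rightarrow> real"
    using integrable_mult_indicator[OF _ that, of A] by simp
  \<comment> \<open>Absorbing the indicator keeps \<open>z\<close> measurable for \<open>F\<close>,
    so the cross term with the noise integrates to 0 over \<open>A\<close>.\<close>
  define z where "z \<omega> = indicator A \<omega> *\<^sub>R (y \<omega> + h *\<^sub>R w \<omega>)" for \<omega>
  have zF: "z \<in> borel_measurable F"
    unfolding z_def using y w A by measurable
  have zM: "z \<in> borel_measurable M"
    using measurable_from_subalg[OF subalg zF] .
  have "integrable M (\<lambda>\<omega>. (norm (y \<omega> + h *\<^sub>R w \<omega>))\<^sup>2)"
    using y_int w_int by (intro integrable_power2_norm_add) (simp_all add: power_mult_distrib)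
  moreover have "(norm (z \<omega>))\<^sup>2 = indicator A \<omega> * (norm (y \<omega> + h *\<^sub>R w \<omega>))\<^sup>2" for \<omega>
    by (simp add: z_def indicator_def)
  ultimately have z_int: "integrable M (\<lambda>\<omega>. (norm (z \<omega>))\<^sup>2)"
    using ind by simp
  have cross: "(\<integral>\<omega>. z \<omega> \<bullet> \<xi> \<omega> \<partial>M) = 0"
    by (rule integral_inner_cond_exp_0) (use zF z_int \<xi>_int mart in auto)
  have cross_int: "integrable M (\<lambda>\<omega>. z \<omega> \<bullet> \<xi> \<omega>)"
    by (rule integrable_inner_of_power2) (use zM z_int \<xi>_int in auto)
  note ints = ind[OF y_int] ind[OF w_int] ind[OF \<xi>_int]
  let ?Y = "\<integral>\<omega>. indicator A \<omega> * (norm (y \<omega>))\<^sup>2 \<partial>M"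
  let ?W = "\<integral>\<omega>. indicator A \<omega> * (norm (w \<omega>))\<^sup>2 \<partial>M"
  let ?\<Xi> = "\<integral>\<omega>. indicator A \<omega> * (norm (\<xi> \<omega>))\<^sup>2 \<partial>M"
  have "?\<Xi> = (\<integral>\<omega>. indicator A \<omega> * real_cond_exp M F (\<lambda>\<omega>. (norm (\<xi> \<omega>))\<^sup>2) \<omega> \<partial>M)"
    using real_cond_exp_intg(2)[OF ints(3)] A by simp
  also have "\<dots> \<le> (\<integral>\<omega>. \<tau> * (indicator A \<omega> * (norm (w \<omega>))\<^sup>2) \<partial>M)"
  proof (rule integral_mono_AE)
    show "integrable M (\<lambda>\<omega>. indicator A \<omega> * real_cond_exp M F (\<lambda>\<omega>. (norm (\<xi> \<omega>))\<^sup>2) \<omega>)"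
      using real_cond_exp_intg(1)[OF ints(3)] A by simp
    show "integrable M (\<lambda>\<omega>. \<tau> * (indicator A \<omega> * (norm (w \<omega>))\<^sup>2))"
      using ints(2) by simp
    show "AE \<omega> in M. indicator A \<omega> * real_cond_exp M F (\<lambda>\<omega>. (norm (\<xi> \<omega>))\<^sup>2) \<omega>
        \<le> \<tau> * (indicator A \<omega> * (norm (w \<omega>))\<^sup>2)"
      using var by eventually_elim (simp add: indicator_def)
  qed
  finally have noise: "?\<Xi> \<le> \<tau> * ?W"
    by simp
  have expand: "(norm (a + h *\<^sub>R (b + c)))\<^sup>2 =
      (norm a)\<^sup>2 + 2 * h * (a \<bullet> b) + h\<^sup>2 * (norm b)\<^sup>2 + h\<^sup>2 * (norm c)\<^sup>2 + 2 * h * ((a + h *\<^sub>R b) \<bullet> c)"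
    for a b c :: "real ^ 'k"
    unfolding power2_norm_eq_inner
    by (simp add: inner_commute inner_left_distrib inner_right_distrib algebra_simps power2_eq_square)
  have pt: "indicator A \<omega> * (norm (y \<omega> + h *\<^sub>R (w \<omega> + \<xi> \<omega>)))\<^sup>2
      \<le> indicator A \<omega> * (norm (y \<omega>))\<^sup>2 + (h\<^sup>2 - 2 * h * lam) * (indicator A \<omega> * (norm (w \<omega>))\<^sup>2)
        + h\<^sup>2 * (indicator A \<omega> * (norm (\<xi> \<omega>))\<^sup>2) + 2 * h * (z \<omega> \<bullet> \<xi> \<omega>)" for \<omega>
  proof (cases "\<omega> \<in> A")
    case True
    have "2 * h * (y \<omega> \<bullet> w \<omega>) \<le> 2 * h * (- lam * (norm (w \<omega>))\<^sup>2)"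
      using h(1) coco by (intro mult_left_mono) auto
    also have "\<dots> = (- 2 * h * lam) * (norm (w \<omega>))\<^sup>2"
      by simp
    finally have "2 * h * (y \<omega> \<bullet> w \<omega>) \<le> - (2 * h * lam * (norm (w \<omega>))\<^sup>2)"
      by simp
    moreover have "indicator A \<omega> = (1 :: real)"
      using True by simp
    ultimately show ?thesis
      unfolding z_def expand left_diff_distrib by (simp only: mult_1 scaleR_one)
  qed (simp add: z_def)
  have "(\<integral>\<omega>. indicator A \<omega> * (norm (y \<omega> + h *\<^sub>R (w \<omega> + \<xi> \<omega>)))\<^sup>2 \<partial>M)
      \<le> (\<integral>\<omega>. indicator A \<omega> * (norm (y \<omega>))\<^sup>2 + (h\<^sup>2 - 2 * h * lam) * (indicator A \<omega> * (norm (w \<omega>))\<^sup>2)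
        + h\<^sup>2 * (indicator A \<omega> * (norm (\<xi> \<omega>))\<^sup>2) + 2 * h * (z \<omega> \<bullet> \<xi> \<omega>) \<partial>M)"
  proof (rule integral_mono'[OF _ pt])
    \<comment> \<open>The upper bound dominates a square times an indicator, hence is nonnegative
      although single terms may be negative.\<close>
    show "0 \<le> indicator A \<omega> * (norm (y \<omega>))\<^sup>2 + (h\<^sup>2 - 2 * h * lam) * (indicator A \<omega> * (norm (w \<omega>))\<^sup>2)
        + h\<^sup>2 * (indicator A \<omega> * (norm (\<xi> \<omega>))\<^sup>2) + 2 * h * (z \<omega> \<bullet> \<xi> \<omega>)" for \<omega>
      by (rule order_trans[OF _ pt]) simp
  qed (use ints cross_int in simp)
  also have "\<dots> = ?Y + (h\<^sup>2 - 2 * h * lam) * ?W + h\<^sup>2 * ?\<Xi>"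
    using ints cross_int cross by simp
  also have "\<dots> \<le> ?Y + (h\<^sup>2 - 2 * h * lam) * ?W + h\<^sup>2 * (\<tau> * ?W)"
    using noise by (simp add: mult_left_mono)
  also have "\<dots> = ?Y + h * (h * (1 + \<tau>)) * ?W - 2 * h * lam * ?W"
    by (simp add: algebra_simps power2_eq_square)
  \<comment> \<open>The step-size condition lets the second-order terms consume only half of the
    decrease.\<close>
  also have "\<dots> \<le> ?Y + h * lam * ?W - 2 * h * lam * ?W"
    using h by (intro diff_right_mono add_left_mono mult_right_mono mult_left_mono) simp_all
  finally show ?thesis
    by simp
qed

section \<open>Almost sure convergence to the set of equilibria\<close>

theorem theorem4p3:
  fixes pl :: "'k::finite \<Rightarrow> 'p::finite"
    and u :: "'p \<Rightarrow> real ^ 'k \<Rightarrow> real"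
    and M :: "'w measure"
    and F :: "nat \<Rightarrow> 'w measure"
    and X \<xi> :: "nat \<Rightarrow> 'w \<Rightarrow> real ^ 'k"
    and x0 :: "real ^ 'k"
    and \<eta> \<tau>s :: "nat \<Rightarrow> real"
    and lam \<tau> \<eta>_lo \<eta>_hi :: real
  assumes "lam > 0"
    and "cocoercive_game lam pl u"
    and "nash_equilibria pl u \<noteq> {}"
    and "prob_space M"
    and "filtration (space M) F"
    and "\<And>t. subalgebra M (F t)"
    and "\<And>t. X t \<in> borel_measurable (F t)"
    and "L2_bounded_martingale_difference M F \<xi>"
    and "\<And>\<omega>. \<omega> \<in> space M \<Longrightarrow> X 0 \<omega> = x0"
    and "\<And>t \<omega>. \<omega> \<in> space M \<Longrightarrow>
           X (Suc t) \<omega> = X t \<omega> + \<eta> (Suc t) *\<^sub>R (game_gradient pl u (X t \<omega>) + \<xi> (Suc t) \<omega>)"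
    and "\<And>t. AE \<omega> in M. real_cond_exp M (F t) (\<lambda>\<omega>. (norm (\<xi> (Suc t) \<omega>))\<^sup>2) \<omega>
                          \<le> \<tau>s t * (norm (game_gradient pl u (X t \<omega>)))\<^sup>2"
    and "\<And>t. 0 < \<tau>s t \<and> \<tau>s t \<le> \<tau>"
    and "\<And>s t. 1 \<le> s \<Longrightarrow> s \<le> t \<Longrightarrow> \<eta> t \<le> \<eta> s"
    and "0 < \<eta>_lo"
    and "\<And>t. 1 \<le> t \<Longrightarrow> \<eta>_lo \<le> \<eta> t \<and> \<eta> t \<le> \<eta>_hi"
    and "\<eta>_hi < lam / (1 + \<tau>)"
  shows "AE \<omega> in M. (\<lambda>t. infdist (X t \<omega>) (nash_equilibria pl u)) \<longlonglongrightarrow> 0"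
proof -
  note lam = assms(1) and coco = assms(2) and filt = assms(5) and sub = assms(6)
    and X_F = assms(7) and step = assms(10) and var = assms(11) and \<tau>s = assms(12)
    and \<eta> = assms(15)
  interpret prob_space M by fact
  interpret sub: finite_measure_subalgebra M "F t" for t
    by unfold_locales (rule sub)
  let ?v = "game_gradient pl u"
  have nash: "nash_equilibria pl u = {x. ?v x = 0}"
    using nash_iff_game_gradient_0[OF coco] lam by auto
  obtain xs where xs: "?v xs = 0"
    using assms(3) nash by blast
  have lip: "(1 / lam)-lipschitz_on UNIV ?v"
    by (rule lipschitz_game_gradient[OF coco lam])
  then have cont: "continuous_on UNIV ?v"
    by (rule lipschitz_on_continuous_on)
  have v_borel: "?v \<in> borel_measurable borel"
    by (rule borel_measurable_continuous_onI[OF cont])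
  \<comment> \<open>This lets integrability of the squared distance to \<open>xs\<close> pass to the
    squared gradient norm.\<close>
  have v_bound: "(norm (?v x))\<^sup>2 \<le> (1 / lam)\<^sup>2 * (norm (x - xs))\<^sup>2" for x
  proof -
    have "norm (?v x) \<le> 1 / lam * norm (x - xs)"
      using lipschitz_onD[OF lip, of x xs] xs by (simp add: dist_norm)
    from power_mono[OF this norm_ge_zero] show ?thesis
      by (simp only: power_mult_distrib)
  qed
  have "\<tau> > 0"
    using \<tau>s[of 0] by linarith
  \<comment> \<open>The bounds on \<open>\<eta>\<close> start at index 1, and the step out of
    \<open>X t\<close> uses \<open>\<eta> (Suc t)\<close>, so time 0 is covered.\<close>
  have rate: "\<eta> (Suc t) * (1 + \<tau>s t) \<le> lam" "\<eta>_lo \<le> \<eta> (Suc t)" "0 \<le> \<eta> (Suc t)" for t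
  proof -
    show lo: "\<eta>_lo \<le> \<eta> (Suc t)" and pos: "0 \<le> \<eta> (Suc t)"
      using \<eta>[of "Suc t"] assms(14) by auto
    have "\<eta> (Suc t) * (1 + \<tau>s t) \<le> \<eta>_hi * (1 + \<tau>)"
      using \<eta>[of "Suc t"] \<tau>s[of t] pos \<open>\<tau> > 0\<close> by (intro mult_mono) auto
    also have "\<dots> \<le> lam"
      using assms(16) \<open>\<tau> > 0\<close> by (simp add: pos_less_divide_eq less_imp_le)
    finally show "\<eta> (Suc t) * (1 + \<tau>s t) \<le> lam" .
  qed
  have \<xi>_F: "\<xi> (Suc t) \<in> borel_measurable (F (Suc t))"
    and \<xi>_int: "integrable M (\<lambda>\<omega>. (norm (\<xi> (Suc t) \<omega>))\<^sup>2)"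
    and mart: "AE \<omega> in M. real_cond_exp M (F t) (\<lambda>\<omega>. \<xi> (Suc t) \<omega> $ k) \<omega> = 0" for t k
    using assms(8) by (simp_all add: L2_bounded_martingale_difference_def)
  have v_F: "(\<lambda>\<omega>. ?v (X t \<omega>)) \<in> borel_measurable (F t)" for t
    using measurable_compose[OF X_F v_borel] .
  have Y_F: "(\<lambda>\<omega>. X t \<omega> - xs) \<in> borel_measurable (F t)" for t
    using X_F by measurable
  note \<xi>_meas [measurable] = measurable_from_subalg[OF sub \<xi>_F]
    and v_M [measurable] = measurable_from_subalg[OF sub v_F]
    and Y_M [measurable] = measurable_from_subalg[OF sub Y_F]
  define D where "D = (\<lambda>t \<omega>. (norm (X t \<omega> - xs))\<^sup>2)"
  define V where "V = (\<lambda>t \<omega>. (norm (?v (X t \<omega>)))\<^sup>2)"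
  have D_Suc: "D (Suc t) \<omega> = (norm ((X t \<omega> - xs) + \<eta> (Suc t) *\<^sub>R (?v (X t \<omega>) + \<xi> (Suc t) \<omega>)))\<^sup>2"
    if "\<omega> \<in> space M" for t \<omega>
    using step[OF that] by (simp add: D_def algebra_simps)
  have V_int: "integrable M (V t)" if "integrable M (D t)" for t
  proof (rule Bochner_Integration.integrable_bound)
    show "integrable M (\<lambda>\<omega>. (1 / lam)\<^sup>2 * D t \<omega>)"
      using that by simp
    show "V t \<in> borel_measurable M"
      unfolding V_def by measurable
    show "AE \<omega> in M. norm (V t \<omega>) \<le> norm ((1 / lam)\<^sup>2 * D t \<omega>)"
      using v_bound by (simp add: V_def D_def)
  qed
  \<comment> \<open>The start is constant; afterwards \<open>D t\<close> controls
    \<open>V t\<close>, and with the noise both control \<open>D (Suc t)\<close>.\<close>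
  have D_int: "integrable M (D t)" for t
  proof (induction t)
    case 0
    have "integrable M (D 0) \<longleftrightarrow> integrable M (\<lambda>\<omega>. (norm (x0 - xs))\<^sup>2)"
      by (rule Bochner_Integration.integrable_cong) (simp_all add: D_def assms(9))
    then show ?case
      by simp
  next
    case (Suc t)
    have "integrable M (\<lambda>\<omega>. (norm (?v (X t \<omega>) + \<xi> (Suc t) \<omega>))\<^sup>2)"
      using V_int[OF Suc] \<xi>_int unfolding V_def by (intro integrable_power2_norm_add) simp_all
    then have "integrable M (\<lambda>\<omega>. (norm ((X t \<omega> - xs) + \<eta> (Suc t) *\<^sub>R (?v (X t \<omega>) + \<xi> (Suc t) \<omega>)))\<^sup>2)"
      using Suc unfolding D_def by (intro integrable_power2_norm_add) (simp_all add: power_mult_distrib)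
    then show ?case
      by (simp add: D_Suc cong: Bochner_Integration.integrable_cong)
  qed
  have descent: "(\<integral>\<omega>. indicator A \<omega> * D (Suc t) \<omega> \<partial>M) \<le> (\<integral>\<omega>. indicator A \<omega> * D t \<omega> \<partial>M)
      - \<eta> (Suc t) * lam * (\<integral>\<omega>. indicator A \<omega> * V t \<omega> \<partial>M)" if A: "A \<in> sets (F t)" for A t
  proof -
    have "(\<integral>\<omega>. indicator A \<omega> * D (Suc t) \<omega> \<partial>M) =
        (\<integral>\<omega>. indicator A \<omega> * (norm ((X t \<omega> - xs) + \<eta> (Suc t) *\<^sub>R (?v (X t \<omega>) + \<xi> (Suc t) \<omega>)))\<^sup>2 \<partial>M)"
      by (rule Bochner_Integration.integral_cong) (simp_all add: D_Suc)
    also have "\<dots> \<le> (\<integral>\<omega>. indicator A \<omega> * D t \<omega> \<partial>M)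
      - \<eta> (Suc t) * lam * (\<integral>\<omega>. indicator A \<omega> * V t \<omega> \<partial>M)"
      unfolding D_def V_def
    proof (rule sub.sgd_step_descent[OF Y_F v_F \<xi>_meas _ _ \<xi>_int mart var _ rate(3,1) A])
      show "(X t \<omega> - xs) \<bullet> ?v (X t \<omega>) \<le> - lam * (norm (?v (X t \<omega>)))\<^sup>2" for \<omega>
        \<comment> \<open>Cocoercivity between \<open>xs\<close> and \<open>X t \<omega>\<close>,
          where the gradient at \<open>xs\<close> is 0.\<close>
        using coco xs unfolding cocoercive_game_def by (metis diff_zero)
    qed (use D_int[of t] V_int[OF D_int, of t] in \<open>simp_all add: D_def V_def\<close>)
    finally show ?thesis .
  qed
  have V_nonneg: "0 \<le> V t \<omega>" for t \<omega>
    by (simp add: V_def)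
  have bdd: "AE \<omega> in M. \<exists>c. \<forall>t. D t \<omega> \<le> c"
  proof (rule supermartingale_AE_bounded[OF filt sub])
    show "D t \<in> borel_measurable (F t)" for t
      unfolding D_def using Y_F by measurable
    show "(\<integral>\<omega>. indicator A \<omega> * D (Suc t) \<omega> \<partial>M) \<le> (\<integral>\<omega>. indicator A \<omega> * D t \<omega> \<partial>M)"
      if "A \<in> sets (F t)" for A t
    proof -
      have "0 \<le> \<eta> (Suc t) * lam * (\<integral>\<omega>. indicator A \<omega> * V t \<omega> \<partial>M)"
        using rate(3) lam V_nonneg by (intro mult_nonneg_nonneg integral_nonneg) auto
      with descent[OF that] show ?thesis
        by linarith
    qed
  qed (rule D_int, simp add: D_def)
  have "AE \<omega> in M. (\<lambda>t. V t \<omega>) \<longlonglongrightarrow> 0"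
  proof (rule AE_tendsto_0_of_summable_integral[OF V_int[OF D_int] V_nonneg])
    fix n
    \<comment> \<open>Summing \<open>descent\<close> over the whole space; the lower bound
      \<open>\<eta>_lo\<close> gives all terms one common positive coefficient.\<close>
    have telescope: "\<eta>_lo * lam * (\<Sum>t<n. expectation (V t)) \<le> expectation (D 0) - expectation (D n)"
    proof (induction n)
      case (Suc n)
      have "space M \<in> sets (F n)"
        using filtration.space_F[OF filt] by (metis sets.top)
      then have "expectation (D (Suc n)) \<le> expectation (D n) - \<eta> (Suc n) * lam * expectation (V n)"
        using descent[of "space M" n] by (simp cong: Bochner_Integration.integral_cong)
      moreover have "\<eta>_lo * lam * expectation (V n) \<le> \<eta> (Suc n) * lam * expectation (V n)"
        using rate(2) lam V_nonneg by (intro mult_right_mono integral_nonneg) auto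
      ultimately show ?case
        using Suc by (simp add: distrib_left)
    qed simp
    have "0 \<le> expectation (D n)"
      by (simp add: D_def)
    with telescope have "\<eta>_lo * lam * (\<Sum>t<n. expectation (V t)) \<le> expectation (D 0)"
      by linarith
    then show "(\<Sum>t<n. expectation (V t)) \<le> expectation (D 0) / (\<eta>_lo * lam)"
      using lam assms(14) by (simp add: pos_le_divide_eq mult.commute)
  qed
  with bdd show ?thesis
  proof eventually_elim
    case (elim \<omega>)
    then obtain c where c: "\<And>t. D t \<omega> \<le> c"
      by blast
    \<comment> \<open>On this path the iterates stay in a ball around \<open>xs\<close> and their
      gradients tend to 0, so the compactness argument applies.\<close>
    have "norm (X t \<omega> - xs) \<le> sqrt c" for t
      using c[of t] by (simp add: D_def real_le_rsqrt)
    then have "bounded (range (\<lambda>t. X t \<omega>))"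
      by (auto simp: bounded_any_center[of _ xs] dist_norm norm_minus_commute intro!: exI[of _ "sqrt c"])
    moreover have "(\<lambda>t. ?v (X t \<omega>)) \<longlonglongrightarrow> 0"
      using elim(2) by (simp add: V_def tendsto_norm_zero_iff)
    ultimately show ?case
      unfolding nash by (intro infdist_zeros_tendsto_0[OF cont])
  qed
qed

end
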